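(* For each $i\in I$, the kernel of the screening operator $S_i:\mathcal Y\to\mathcal Y_i$ equals $$\mathcal K_i=\mathbb Z[Y_{j,a}^{\pm1}]_{j\ne i;\,a\in\mathbb C^\times}\otimes\mathbb Z[Y_{i,b}+Y_{i,b}A_{i,bq_i}^{-1}]_{b\in\mathbb C^\times},$$ i.e. the subring of $\mathcal Y$ generated by all $Y_{j,a}^{\pm1}$ with $j\ne i$, $a\in\mathbb C^\times$, and all $Y_{i,b}+Y_{i,b}A_{i,bq_i}^{-1}$, $b\in\mathbb C^\times$.
   Context: $\mathfrak g$ is a simple Lie algebra over $\mathbb C$ with simple roots $\alpha_i$, $i\in I=\{1,\dots,\ell\}$. $r^\vee$ is the maximal number of edges connecting two vertices of the Dynkin diagram, and $(\cdot,\cdot)$ is the invariant inner product on the dual of the Cartan subalgebra normalized so that the maximal root has square length $2r^\vee$. Put $r_i=(\alpha_i,\alpha_i)/2$, $C_{ij}=2(\alpha_i,\alpha_j)/(\alpha_i,\alpha_i)$. Fix $q\in\mathbb C^\times$ with $|q|<1$ and put $q_i=q^{r_i}$. $\mathcal Y=\mathbb Z[Y_{i,a}^{\pm1}]_{i\in I,a\in\mathbb C^\times}$ is the ring of Laurent polynomials in the variables $Y_{i,a}$, and $A_{i,a}=Y_{i,aq_i}Y_{i,aq_i^{-1}}\prod_{C_{ji}=-1}Y_{j,a}^{-1}\prod_{C_{ji}=-2}Y_{j,aq}^{-1}Y_{j,aq^{-1}}^{-1}\prod_{C_{ji}=-3}Y_{j,aq^2}^{-1}Y_{j,a}^{-1}Y_{j,aq^{-2}}^{-1}.$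 Let $\widetilde{\mathcal Y}_i=\bigoplus_{x\in\mathbb C^\times}\mathcal Y\cdot S_{i,x}$ be the free $\mathcal Y$-module on generators $S_{i,x}$, and let $\mathcal Y_i$ be its quotient by the relations $S_{i,xq_i^2}=A_{i,xq_i}S_{i,x}$, $x\in\mathbb C^\times$. Let $\widetilde S_i:\mathcal Y\to\widetilde{\mathcal Y}_i$ be the linear map determined by $\widetilde S_i(Y_{j,a})=\delta_{ij}Y_{i,a}S_{i,a}$ and the Leibniz rule $\widetilde S_i(fg)=g\widetilde S_i(f)+f\widetilde S_i(g)$. The $i$th screening operator $S_i:\mathcal Y\to\mathcal Y_i$ is the composition of $\widetilde S_i$ with the projection $\widetilde{\mathcal Y}_i\to\mathcal Y_i$. *)

theory Defs
  imports "HOL-Analysis.Analysis" "HOL-Library.Poly_Mapping"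
begin

section \<open>Simple complex Lie algebras, Cartan subalgebras and simple roots\<close>

text \<open>The carrier of the Lie algebra is a whole type; its complex vector space structure is the
  explicit scalar multiplication \<open>sc\<close>.\<close>

locale lie_algebra = vector_space sc
  for sc :: "complex \<Rightarrow> 'g::ab_group_add \<Rightarrow> 'g" +
  fixes br :: "'g \<Rightarrow> 'g \<Rightarrow> 'g"
  assumes br_add_left: "br (x + y) z = br x z + br y z"
    and br_scale_left: "br (sc c x) z = sc c (br x z)"
    and br_add_right: "br z (x + y) = br z x + br z y"
    and br_scale_right: "br z (sc c x) = sc c (br z x)"
    and br_self: "br x x = 0"
    and jacobi: "br x (br y z) + br y (br z x) + br z (br x y) = 0"

locale simple_lie_algebra = lie_algebra sc br
  for sc :: "complex \<Rightarrow> 'g::ab_group_add \<Rightarrow> 'g" and br +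
  assumes finite_dim: "\<exists>B. finite B \<and> span B = UNIV"
    and not_abelian: "\<exists>x y. br x y \<noteq> 0"
    and no_proper_ideal:
      "\<And>J. subspace J \<Longrightarrow> (\<forall>x. \<forall>y\<in>J. br x y \<in> J) \<Longrightarrow> J = {0} \<or> J = UNIV"

text \<open>For a semisimple Lie algebra, the Cartan subalgebras are the subalgebras that are abelian,
  self-centralizing and act diagonalizably in the adjoint representation.\<close>

definition cartan_subalgebra ::
  "(complex \<Rightarrow> 'g::ab_group_add \<Rightarrow> 'g) \<Rightarrow> ('g \<Rightarrow> 'g \<Rightarrow> 'g) \<Rightarrow> 'g set \<Rightarrow> bool" where
  "cartan_subalgebra sc br h \<longleftrightarrow>
     module.subspace sc h \<and>
     (\<forall>s\<in>h. \<forall>t\<in>h. br s t = 0) \<and>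
     (\<forall>x. (\<forall>t\<in>h. br t x = 0) \<longrightarrow> x \<in> h) \<and>
     (\<forall>t\<in>h. module.span sc {x. \<exists>c. br t x = sc c x} = UNIV)"

text \<open>Linear functionals on \<open>h\<close> are represented by functions on the whole type that vanish
  outside \<open>h\<close>, so that equality of functionals is equality of functions.\<close>

definition dual_space ::
  "(complex \<Rightarrow> 'g::ab_group_add \<Rightarrow> 'g) \<Rightarrow> 'g set \<Rightarrow> ('g \<Rightarrow> complex) set" where
  "dual_space sc h =
     {f. (\<forall>s\<in>h. \<forall>t\<in>h. f (s + t) = f s + f t) \<and> (\<forall>c. \<forall>t\<in>h. f (sc c t) = c * f t) \<and>
         (\<forall>x. x \<notin> h \<longrightarrow> f x = 0)}"

definition roots ::
  "(complex \<Rightarrow> 'g::ab_group_add \<Rightarrow> 'g) \<Rightarrow> ('g \<Rightarrow> 'g \<Rightarrow> 'g) \<Rightarrow> 'g set \<Rightarrow> ('g \<Rightarrow> complex) set" where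
  "roots sc br h =
     {\<beta> \<in> dual_space sc h. \<beta> \<noteq> (\<lambda>_. 0) \<and> (\<exists>x. x \<noteq> 0 \<and> (\<forall>t\<in>h. br t x = sc (\<beta> t) x))}"

definition simple_roots ::
  "(complex \<Rightarrow> 'g::ab_group_add \<Rightarrow> 'g) \<Rightarrow> ('g \<Rightarrow> 'g \<Rightarrow> 'g) \<Rightarrow> 'g set \<Rightarrow>
   ('i::finite \<Rightarrow> 'g \<Rightarrow> complex) \<Rightarrow> bool" where
  "simple_roots sc br h \<alpha> \<longleftrightarrow>
     (\<forall>i. \<alpha> i \<in> roots sc br h) \<and>
     (\<forall>c. (\<lambda>t. \<Sum>i\<in>UNIV. c i * \<alpha> i t) = (\<lambda>_. 0) \<longrightarrow> (\<forall>i. c i = 0)) \<and>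
     (\<forall>\<beta> \<in> roots sc br h. \<exists>n :: 'i \<Rightarrow> nat.
        \<beta> = (\<lambda>t. \<Sum>i\<in>UNIV. of_nat (n i) * \<alpha> i t) \<or>
        \<beta> = (\<lambda>t. - (\<Sum>i\<in>UNIV. of_nat (n i) * \<alpha> i t)))"

definition maximal_root ::
  "(complex \<Rightarrow> 'g::ab_group_add \<Rightarrow> 'g) \<Rightarrow> ('g \<Rightarrow> 'g \<Rightarrow> 'g) \<Rightarrow> 'g set \<Rightarrow>
   ('i::finite \<Rightarrow> 'g \<Rightarrow> complex) \<Rightarrow> ('g \<Rightarrow> complex) \<Rightarrow> bool" where
  "maximal_root sc br h \<alpha> \<theta> \<longleftrightarrow>
     \<theta> \<in> roots sc br h \<and>
     (\<forall>\<beta> \<in> roots sc br h. \<exists>n :: 'i \<Rightarrow> nat.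
        \<theta> = (\<lambda>t. \<beta> t + (\<Sum>i\<in>UNIV. of_nat (n i) * \<alpha> i t)))"

definition invariant_form ::
  "(complex \<Rightarrow> 'g::ab_group_add \<Rightarrow> 'g) \<Rightarrow> ('g \<Rightarrow> 'g \<Rightarrow> 'g) \<Rightarrow> ('g \<Rightarrow> 'g \<Rightarrow> complex) \<Rightarrow> bool" where
  "invariant_form sc br B \<longleftrightarrow>
     (\<forall>x y z. B (x + y) z = B x z + B y z) \<and>
     (\<forall>c x y. B (sc c x) y = c * B x y) \<and>
     (\<forall>x y. B x y = B y x) \<and>
     (\<forall>x y z. B (br x y) z = B x (br y z)) \<and>
     (\<forall>x. (\<forall>y. B x y = 0) \<longrightarrow> x = 0)"

text \<open>An invariant inner product on the dual of \<open>h\<close> is the complex bilinear form transported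
  from a nondegenerate invariant form on the Lie algebra; \<open>inner product\<close> means that it is
  positive definite on the real span of the roots.\<close>

definition invariant_inner_product ::
  "(complex \<Rightarrow> 'g::ab_group_add \<Rightarrow> 'g) \<Rightarrow> ('g \<Rightarrow> 'g \<Rightarrow> 'g) \<Rightarrow> 'g set \<Rightarrow>
   ('i::finite \<Rightarrow> 'g \<Rightarrow> complex) \<Rightarrow> (('g \<Rightarrow> complex) \<Rightarrow> ('g \<Rightarrow> complex) \<Rightarrow> complex) \<Rightarrow> bool" where
  "invariant_inner_product sc br h \<alpha> ip \<longleftrightarrow>
     (\<exists>B. invariant_form sc br B \<and>
        (\<forall>\<mu> \<in> dual_space sc h. \<forall>\<nu> \<in> dual_space sc h.
           \<exists>s\<in>h. \<exists>t\<in>h. (\<forall>x\<in>h. \<mu> x = B s x) \<and> (\<forall>x\<in>h. \<nu> x = B t x) \<and> ip \<mu> \<nu> = B s t)) \<and>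
     (\<forall>c :: 'i \<Rightarrow> real. (\<exists>i. c i \<noteq> 0) \<longrightarrow>
        (let \<mu> = (\<lambda>t. \<Sum>i\<in>UNIV. of_real (c i) * \<alpha> i t) in ip \<mu> \<mu> \<in> \<real> \<and> Re (ip \<mu> \<mu>) > 0))"

definition cartan_matrix ::
  "(('g \<Rightarrow> complex) \<Rightarrow> ('g \<Rightarrow> complex) \<Rightarrow> complex) \<Rightarrow> ('i \<Rightarrow> 'g \<Rightarrow> complex) \<Rightarrow> 'i \<Rightarrow> 'i \<Rightarrow> complex" where
  "cartan_matrix ip \<alpha> i j = 2 * ip (\<alpha> i) (\<alpha> j) / ip (\<alpha> i) (\<alpha> i)"

text \<open>Distinct vertices \<open>i\<close>, \<open>j\<close> of the Dynkin diagram are joined by \<open>C\<^sub>i\<^sub>j C\<^sub>j\<^sub>i\<close> edges. The value 1 is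
  inserted in the maximum for rank one, where the diagram has no two vertices.\<close>

definition max_edges ::
  "(('g \<Rightarrow> complex) \<Rightarrow> ('g \<Rightarrow> complex) \<Rightarrow> complex) \<Rightarrow> ('i::finite \<Rightarrow> 'g \<Rightarrow> complex) \<Rightarrow> real" where
  "max_edges ip \<alpha> =
     Max (insert 1 {Re (cartan_matrix ip \<alpha> i j * cartan_matrix ip \<alpha> j i) | i j. i \<noteq> j})"


section \<open>Nonzero complex numbers\<close>

typedef cstar = "{z :: complex. z \<noteq> 0}"
  by (rule exI[of _ 1]) simp

setup_lifting type_definition_cstar

instantiation cstar :: "{comm_monoid_mult, inverse}"
begin
lift_definition one_cstar :: cstar is 1 by simp
lift_definition times_cstar :: "cstar \<Rightarrow> cstar \<Rightarrow> cstar" is "(*)" by simp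
lift_definition inverse_cstar :: "cstar \<Rightarrow> cstar" is inverse by simp
lift_definition divide_cstar :: "cstar \<Rightarrow> cstar \<Rightarrow> cstar" is "(/)" by simp
instance by standard (transfer; simp)+
end

text \<open>\<open>qi ip \<alpha> q i\<close> is \<open>q\<close> to the power \<open>r\<^sub>i = (\<alpha>\<^sub>i, \<alpha>\<^sub>i) / 2\<close>. When the maximal root has square
  length \<open>2 * max_edges ip \<alpha>\<close>, \<open>r\<^sub>i\<close> is a positive integer, so that complex \<open>powr\<close> is the ordinary power, with no choice of branch.\<close>

definition rr ::
  "(('g \<Rightarrow> complex) \<Rightarrow> ('g \<Rightarrow> complex) \<Rightarrow> complex) \<Rightarrow> ('i \<Rightarrow> 'g \<Rightarrow> complex) \<Rightarrow> 'i \<Rightarrow> complex" where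
  "rr ip \<alpha> i = ip (\<alpha> i) (\<alpha> i) / 2"

definition qi ::
  "(('g \<Rightarrow> complex) \<Rightarrow> ('g \<Rightarrow> complex) \<Rightarrow> complex) \<Rightarrow> ('i \<Rightarrow> 'g \<Rightarrow> complex) \<Rightarrow> cstar \<Rightarrow> 'i \<Rightarrow> cstar" where
  "qi ip \<alpha> q i = Abs_cstar (Rep_cstar q powr rr ip \<alpha> i)"


section \<open>The ring of Laurent polynomials\<close>

text \<open>Laurent monomials are finitely supported integer exponent vectors indexed by pairs
  \<open>(i, a)\<close>; the Laurent polynomial ring is their group ring over the integers.\<close>

type_synonym 'i yring = "('i \<times> cstar \<Rightarrow>\<^sub>0 int) \<Rightarrow>\<^sub>0 int"

definition YY :: "'i \<Rightarrow> cstar \<Rightarrow> 'i yring" where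
  "YY i a = Poly_Mapping.single (Poly_Mapping.single (i, a) 1) 1"

definition uinv :: "'a::comm_ring_1 \<Rightarrow> 'a" where
  "uinv u = (THE v. u * v = 1)"

lemma uinvI: "u * v = 1 \<Longrightarrow> uinv u = (v :: 'a::comm_ring_1)"
  unfolding uinv_def
  by (rule the_equality) (simp, metis mult.assoc mult.commute mult_1)

lemma YY_uinv: "YY i a * uinv (YY i a) = 1"
  and uinv_YY: "uinv (YY i a) = Poly_Mapping.single (Poly_Mapping.single (i, a) (-1)) 1"
proof -
  have *: "YY i a * Poly_Mapping.single (Poly_Mapping.single (i, a) (-1)) 1 = 1"
    unfolding YY_def mult_single single_add[symmetric] by simp
  show "uinv (YY i a) = Poly_Mapping.single (Poly_Mapping.single (i, a) (-1)) 1"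
    using * by (rule uinvI)
  then show "YY i a * uinv (YY i a) = 1" using * by simp
qed

definition AA ::
  "(('g \<Rightarrow> complex) \<Rightarrow> ('g \<Rightarrow> complex) \<Rightarrow> complex) \<Rightarrow> ('i::finite \<Rightarrow> 'g \<Rightarrow> complex) \<Rightarrow> cstar \<Rightarrow>
   'i \<Rightarrow> cstar \<Rightarrow> 'i yring" where
  "AA ip \<alpha> q i a =
     YY i (a * qi ip \<alpha> q i) * YY i (a * inverse (qi ip \<alpha> q i)) *
     (\<Prod>j | cartan_matrix ip \<alpha> j i = -1. uinv (YY j a)) *
     (\<Prod>j | cartan_matrix ip \<alpha> j i = -2. uinv (YY j (a * q)) * uinv (YY j (a * inverse q))) *
     (\<Prod>j | cartan_matrix ip \<alpha> j i = -3.
        uinv (YY j (a * q^2)) * uinv (YY j a) * uinv (YY j (a * inverse (q^2))))"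

lemma AA_unit:
  fixes \<alpha> :: "'i::finite \<Rightarrow> 'g \<Rightarrow> complex"
  shows "AA ip \<alpha> q i a * uinv (AA ip \<alpha> q i a) = 1"
proof -
  have *: "YY j b dvd 1" "uinv (YY j b) dvd 1" for j :: 'i and b
    by (metis YY_uinv dvd_triv_left, metis YY_uinv dvd_triv_right)
  have prod: "(\<Prod>j\<in>J. f j) dvd 1" if "\<And>j. f j dvd 1" for J and f :: "'i \<Rightarrow> 'i yring"
    using prod_dvd_prod[of J f "\<lambda>_. 1"] that by simp
  have mult: "x * y dvd 1" if "x dvd 1" "y dvd 1" for x y :: "'i yring"
    using mult_dvd_mono[OF that] by simp
  have "AA ip \<alpha> q i a dvd 1"
    unfolding AA_def by (intro mult prod *)
  then show ?thesis
    by (metis dvdE uinvI)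
qed


section \<open>Screening operators\<close>

text \<open>The free module on the generators \<open>S\<^sub>x\<close>, where \<open>x\<close> ranges over the nonzero complex numbers
  (it does not depend on \<open>i\<close>).\<close>

type_synonym 'i sfree = "cstar \<Rightarrow>\<^sub>0 'i yring"

definition smult :: "'i yring \<Rightarrow> 'i sfree \<Rightarrow> 'i sfree" where
  "smult f m = Poly_Mapping.map ((*) f) m"

definition S_gen :: "cstar \<Rightarrow> 'i sfree" where
  "S_gen x = Poly_Mapping.single x 1"

lemma lookup_smult [simp]: "Poly_Mapping.lookup (smult f m) x = f * Poly_Mapping.lookup m x"
  by (simp add: smult_def Poly_Mapping.map.rep_eq when_def)

interpretation sfree: module smult
  by standard (auto intro!: poly_mapping_eqI simp: lookup_add algebra_simps)

definition screening_relations ::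
  "(('g \<Rightarrow> complex) \<Rightarrow> ('g \<Rightarrow> complex) \<Rightarrow> complex) \<Rightarrow> ('i::finite \<Rightarrow> 'g \<Rightarrow> complex) \<Rightarrow> cstar \<Rightarrow>
   'i \<Rightarrow> 'i sfree set" where
  "screening_relations ip \<alpha> q i =
     sfree.span (range (\<lambda>x. S_gen (x * (qi ip \<alpha> q i)^2) -
                            smult (AA ip \<alpha> q i (x * qi ip \<alpha> q i)) (S_gen x)))"

definition screening_cong ::
  "(('g \<Rightarrow> complex) \<Rightarrow> ('g \<Rightarrow> complex) \<Rightarrow> complex) \<Rightarrow> ('i::finite \<Rightarrow> 'g \<Rightarrow> complex) \<Rightarrow> cstar \<Rightarrow>
   'i \<Rightarrow> ('i sfree \<times> 'i sfree) set" where
  "screening_cong ip \<alpha> q i = {(m, n). m - n \<in> screening_relations ip \<alpha> q i}"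

definition screening_module ::
  "(('g \<Rightarrow> complex) \<Rightarrow> ('g \<Rightarrow> complex) \<Rightarrow> complex) \<Rightarrow> ('i::finite \<Rightarrow> 'g \<Rightarrow> complex) \<Rightarrow> cstar \<Rightarrow>
   'i \<Rightarrow> 'i sfree set set" where
  "screening_module ip \<alpha> q i = UNIV // screening_cong ip \<alpha> q i"

definition is_screening_tilde :: "'i \<Rightarrow> ('i yring \<Rightarrow> 'i sfree) \<Rightarrow> bool" where
  "is_screening_tilde i D \<longleftrightarrow>
     (\<forall>f g. D (f + g) = D f + D g) \<and>
     (\<forall>j a. D (YY j a) = (if i = j then smult (YY i a) (S_gen a) else 0)) \<and>
     (\<forall>f g. D (f * g) = smult g (D f) + smult f (D g))"

lemma poly_mapping_induct [case_names single sum]: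
  fixes P :: "('k \<Rightarrow>\<^sub>0 'v::monoid_add) \<Rightarrow> bool"
  assumes single: "\<And>k v. P (Poly_Mapping.single k v)"
    and sum: "\<And>f g. P f \<Longrightarrow> P g \<Longrightarrow> P (f + g)"
  shows "P f"
proof (induction f rule: update_induct)
  case const
  then show ?case using single[of undefined 0] by simp
next
  case (update f k v)
  then have "Poly_Mapping.update k v f = f + Poly_Mapping.single k v"
    by (intro poly_mapping_eqI)
       (auto simp: lookup_update lookup_add lookup_single in_keys_iff when_def)
  then show ?case using update sum single by simp
qed

lemma is_screening_tilde_unique: "\<exists>!D. is_screening_tilde i D"
proof -
  let ?D0 = "\<lambda>m c. \<Sum>x | (i, x) \<in> Poly_Mapping.keys m.
    smult (Poly_Mapping.single m (c * Poly_Mapping.lookup m (i, x))) (S_gen x)"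
  define D where "D p = (\<Sum>m\<in>Poly_Mapping.keys p. ?D0 m (Poly_Mapping.lookup p m))" for p :: "'a yring"
  have look0: "Poly_Mapping.lookup (?D0 m c) x = Poly_Mapping.single m (c * Poly_Mapping.lookup m (i, x))" for m c x
  proof -
    have fin: "finite {x. (i, x) \<in> Poly_Mapping.keys m}"
      by (rule finite_subset[of _ "snd ` Poly_Mapping.keys m"]) force+
    have "Poly_Mapping.lookup (?D0 m c) x =
        (\<Sum>y | (i, y) \<in> Poly_Mapping.keys m. if y = x then Poly_Mapping.single m (c * Poly_Mapping.lookup m (i, x)) else 0)"
      unfolding lookup_sum by (intro sum.cong) (auto simp: S_gen_def lookup_single when_def)
    then show ?thesis
      using fin by (auto simp: in_keys_iff)
  qed
  have look: "Poly_Mapping.lookup (Poly_Mapping.lookup (D p) x) m = Poly_Mapping.lookup p m * Poly_Mapping.lookup m (i, x)" for p x m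
  proof -
    have "Poly_Mapping.lookup (D p) x =
        (\<Sum>n\<in>Poly_Mapping.keys p.
          Poly_Mapping.single n (Poly_Mapping.lookup p n * Poly_Mapping.lookup n (i, x)))"
      unfolding D_def by (subst lookup_sum) (simp only: look0)
    then have "Poly_Mapping.lookup (Poly_Mapping.lookup (D p) x) m =
        (\<Sum>n\<in>Poly_Mapping.keys p.
          if n = m then Poly_Mapping.lookup p m * Poly_Mapping.lookup m (i, x) else 0)"
      by (simp only: lookup_sum, intro sum.cong) (auto simp: lookup_single when_def)
    then show ?thesis by (auto simp: in_keys_iff)
  qed
  have add: "D (f + g) = D f + D g" for f g
    by (intro poly_mapping_eqI) (simp add: look lookup_add algebra_simps)
  have mono: "Poly_Mapping.lookup (D (Poly_Mapping.single m c)) x = Poly_Mapping.single m (c * Poly_Mapping.lookup m (i, x))"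
    for m c x
    by (intro poly_mapping_eqI) (auto simp: look lookup_single when_def)
  have zero: "D 0 = 0" using add[of 0 0] by simp
  have leib1: "D (Poly_Mapping.single m c * Poly_Mapping.single n d) =
      smult (Poly_Mapping.single n d) (D (Poly_Mapping.single m c)) +
      smult (Poly_Mapping.single m c) (D (Poly_Mapping.single n d))" for m n c d
    by (intro poly_mapping_eqI[where 'a = cstar])
       (simp only: lookup_add lookup_smult mono mult_single,
        simp add: single_add[symmetric] algebra_simps lookup_add)
  have leib2: "D (Poly_Mapping.single m c * g) =
      smult g (D (Poly_Mapping.single m c)) + smult (Poly_Mapping.single m c) (D g)" for m c g
  proof (induction g rule: poly_mapping_induct)
    case (single n d)
    then show ?case by (rule leib1)
  next
    case (sum g h)
    then show ?case
      by (simp add: add distrib_left sfree.scale_left_distrib sfree.scale_right_distrib)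
  qed
  have leib: "D (f * g) = smult g (D f) + smult f (D g)" for f g
  proof (induction f rule: poly_mapping_induct)
    case (single m c)
    then show ?case by (rule leib2)
  next
    case (sum f h)
    then show ?case
      by (simp add: add distrib_right sfree.scale_left_distrib sfree.scale_right_distrib)
  qed
  have gen: "D (YY j a) = (if i = j then smult (YY i a) (S_gen a) else 0)" for j a
    by (intro poly_mapping_eqI[where 'a = cstar])
       (simp only: YY_def mono, auto simp: S_gen_def YY_def lookup_single when_def)
  have ex: "is_screening_tilde i D"
    unfolding is_screening_tilde_def using add gen leib by blast
  moreover have "E = D" if E: "is_screening_tilde i E" for E
  proof
    fix p
    define Z where "Z f = E f - D f" for f
    have Zadd: "Z (f + g) = Z f + Z g" for f g
      using E add unfolding is_screening_tilde_def Z_def by simp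
    have Zmult: "Z (f * g) = smult g (Z f) + smult f (Z g)" for f g
      using E leib unfolding is_screening_tilde_def Z_def
      by (simp add: sfree.scale_right_diff_distrib)
    have ZY: "Z (YY j a) = 0" for j a
      using E gen unfolding is_screening_tilde_def Z_def by simp
    interpret Z: additive Z by standard (rule Zadd)
    have Z1: "Z 1 = 0" using Zmult[of 1 1] by simp
    have Zinv: "Z (uinv (YY j a)) = 0" for j a
    proof -
      have "smult (YY j a) (Z (uinv (YY j a))) = 0"
        using Zmult[of "YY j a" "uinv (YY j a)"] by (simp add: YY_uinv Z1 ZY)
      then have "smult (uinv (YY j a)) (smult (YY j a) (Z (uinv (YY j a)))) = 0" by simp
      then show ?thesis
        using YY_uinv[of j a] by (simp add: mult.commute)
    qed
    have Zpow: "Z (Poly_Mapping.single (Poly_Mapping.single k (of_nat n * s)) 1) = 0"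
      if "s = 1 \<or> s = -1" for k n and s :: int
    proof (induction n)
      case 0
      then show ?case using Z1 by simp
    next
      case (Suc n)
      obtain j a where k: "k = (j, a)" by fastforce
      have "Z (Poly_Mapping.single (Poly_Mapping.single k s) 1) = 0"
        using that ZY[of j a, unfolded YY_def] Zinv[of j a, unfolded uinv_YY] by (auto simp only: k)
      moreover have "Poly_Mapping.single (Poly_Mapping.single k (of_nat (Suc n) * s)) 1 =
          Poly_Mapping.single (Poly_Mapping.single k s) 1 *
          Poly_Mapping.single (Poly_Mapping.single k (of_nat n * s)) (1 :: int)"
        by (simp only: mult_single single_add[symmetric]) (simp add: algebra_simps)
      ultimately show ?case by (simp only: Zmult Suc) simp
    qed
    have Zsing: "Z (Poly_Mapping.single (Poly_Mapping.single k c) 1) = 0" for k c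
      using Zpow[of 1 k "nat c"] Zpow[of "-1" k "nat (- c)"] by (cases "c \<ge> 0") simp_all
    have Zmono: "Z (Poly_Mapping.single m 1) = 0" for m
    proof (induction m rule: poly_mapping_induct)
      case (single k c)
      then show ?case by (rule Zsing)
    next
      case (sum m n)
      have "Poly_Mapping.single (m + n) 1 =
          Poly_Mapping.single m 1 * Poly_Mapping.single n (1 :: int)"
        by (simp only: mult_single) simp
      then show ?case by (simp only: Zmult sum) simp
    qed
    have Znat: "Z (of_nat n) = 0" for n
      by (induction n) (simp_all add: Zadd Z1 Z.zero)
    have Zint: "Z (of_int c) = 0" for c
      by (cases c rule: int_cases2) (simp_all add: Z.minus Znat)
    have "Z p = 0"
    proof (induction p rule: poly_mapping_induct)
      case (single m c)
      have "Poly_Mapping.single m c = of_int c * Poly_Mapping.single m (1 :: int)"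
        by (simp only: single_of_int[symmetric] mult_single) simp
      then show ?case by (simp only: Zmult Zmono Zint) simp
    next
      case (sum f g)
      then show ?case by (simp add: Zadd)
    qed
    then show "E p = D p" by (simp add: Z_def)
  qed
  ultimately show ?thesis by blast
qed

definition screening_tilde :: "'i \<Rightarrow> 'i yring \<Rightarrow> 'i sfree" where
  "screening_tilde i = (THE D. is_screening_tilde i D)"

definition screening ::
  "(('g \<Rightarrow> complex) \<Rightarrow> ('g \<Rightarrow> complex) \<Rightarrow> complex) \<Rightarrow> ('i::finite \<Rightarrow> 'g \<Rightarrow> complex) \<Rightarrow> cstar \<Rightarrow>
   'i \<Rightarrow> 'i yring \<Rightarrow> 'i sfree set" where
  "screening ip \<alpha> q i f = screening_cong ip \<alpha> q i `` {screening_tilde i f}"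

lemma screening_in_module: "screening ip \<alpha> q i f \<in> screening_module ip \<alpha> q i"
  unfolding screening_def screening_module_def by (rule quotientI) simp

definition screening_kernel ::
  "(('g \<Rightarrow> complex) \<Rightarrow> ('g \<Rightarrow> complex) \<Rightarrow> complex) \<Rightarrow> ('i::finite \<Rightarrow> 'g \<Rightarrow> complex) \<Rightarrow> cstar \<Rightarrow>
   'i \<Rightarrow> 'i yring set" where
  "screening_kernel ip \<alpha> q i = {f. screening ip \<alpha> q i f = screening_cong ip \<alpha> q i `` {0}}"

definition is_subring :: "'a::ring_1 set \<Rightarrow> bool" where
  "is_subring R \<longleftrightarrow> 1 \<in> R \<and> (\<forall>x\<in>R. \<forall>y\<in>R. x - y \<in> R \<and> x * y \<in> R)"

text \<open>The tensor product of the two rings is read inside the Laurent polynomial ring, as the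
  subring generated by the generators of both factors.\<close>

definition KK ::
  "(('g \<Rightarrow> complex) \<Rightarrow> ('g \<Rightarrow> complex) \<Rightarrow> complex) \<Rightarrow> ('i::finite \<Rightarrow> 'g \<Rightarrow> complex) \<Rightarrow> cstar \<Rightarrow>
   'i \<Rightarrow> 'i yring set" where
  "KK ip \<alpha> q i = is_subring hull
     ({YY j a | j a. j \<noteq> i} \<union> {uinv (YY j a) | j a. j \<noteq> i} \<union>
      {YY i b + YY i b * uinv (AA ip \<alpha> q i (b * qi ip \<alpha> q i)) | b. True})"

end

theory Submission
  imports Defs
begin

text \<open>The Lie theory is used through two facts. Positivity of the inner product makes \<open>r\<^sub>i\<close> a positive
  real number, so that \<open>t = q\<^sub>i\<^sup>2\<close> has modulus less than 1 and multiplication by \<open>t\<close> has infinite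
  orbits; and \<open>C\<^sub>i\<^sub>i = 2\<close>, so that \<open>A\<^sub>x = A\<^bsub>i,xq\<^sub>i\<^esub>\<close> is \<open>y\<^sub>x y\<^bsub>xt\<^esub>\<close> times a monomial in the variables
  with index \<open>j \<noteq> i\<close>, where \<open>y\<^sub>x = Y\<^bsub>i,x\<^esub>\<close>. The rest is an argument about
  such a family of monomials, which ends in \<open>kernel_eq_zsub\<close>.

  Write \<open>D\<^sub>x = y\<^sub>x \<partial>/\<partial>y\<^sub>x\<close> for the coefficient of \<open>S\<^sub>x\<close> in the lifted screening operator. Then \<open>f\<close> lies
  in the kernel if and only if there is a finitely supported family \<open>G\<close> of Laurent polynomials with
  \<open>D\<^bsub>xt\<^esub> f = G\<^sub>x - A\<^bsub>xt\<^esub> G\<^bsub>xt\<^esub>\<close> for all \<open>x\<close>. The elements \<open>z\<^sub>b = y\<^sub>b + y\<^sub>b A\<^sub>b\<^sup>-\<^sup>1\<close> are in the kernel, and the kernel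
  is a ring, which gives one inclusion.

  For the other one, let \<open>F\<close> be a finite set containing all \<open>x\<close> for which \<open>y\<^sub>x\<close> occurs in \<open>f\<close>, and
  without gaps along the orbits of \<open>t\<close>. Induct on the size of \<open>F\<close>. Let \<open>b\<close> be of maximal modulus in
  \<open>F\<close>; it is the first point of \<open>F\<close> on its orbit. Since \<open>G\<close> is finitely supported, it vanishes before
  \<open>b\<close>, so that \<open>D\<^sub>b f = - A\<^sub>b G\<^sub>b\<close>. Here \<open>G\<^sub>b\<close> is built from \<open>f\<close> by operations that do not involve \<open>y\<^sub>b\<close>,
  whereas \<open>A\<^sub>b\<close> raises the degree in \<open>y\<^sub>b\<close> by one; comparing the lowest terms shows that \<open>f\<close> is a
  polynomial in \<open>y\<^sub>b\<close>. If \<open>bt \<notin> F\<close>, then even \<open>G\<^sub>b = 0\<close> and \<open>y\<^sub>b\<close> does not occur in \<open>f\<close>. If \<open>bt \<in> F\<close>,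
  then \<open>z\<^sub>b\<close> only involves variables from \<open>F\<close>, and \<open>f\<close> can be expanded in powers of \<open>z\<^sub>b\<close>: its leading
  coefficient \<open>f\<^sub>d\<close> is again in the kernel and does not contain \<open>y\<^sub>b\<close>, so it is covered by induction,
  and \<open>f - z\<^sub>b\<^sup>d f\<^sub>d\<close> has smaller degree.\<close>

section \<open>Coefficients of Laurent polynomials\<close>

abbreviation cf :: "('k \<Rightarrow>\<^sub>0 'v::zero) \<Rightarrow> 'k \<Rightarrow> 'v" where
  "cf \<equiv> Poly_Mapping.lookup"

abbreviation lmon :: "('i \<times> cstar \<Rightarrow>\<^sub>0 int) \<Rightarrow> 'i yring" where
  "lmon \<mu> \<equiv> Poly_Mapping.single \<mu> 1"

lemma lookup_single_mult:
  fixes f :: "'k::ab_group_add \<Rightarrow>\<^sub>0 'v::comm_ring_1"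
  shows "cf (Poly_Mapping.single k c * f) m = c * cf f (m - k)"
proof (induction f rule: poly_mapping_induct)
  case (single n d)
  have "k + n = m \<longleftrightarrow> n = m - k" by (auto simp: algebra_simps)
  then show ?case by (auto simp: mult_single lookup_single when_def)
next
  case (sum f g)
  then show ?case by (simp add: distrib_left lookup_add)
qed

lemma lmon_add: "lmon (\<mu> + \<nu>) = lmon \<mu> * lmon \<nu>"
  by (simp add: mult_single)

lemma uinv_lmon: "uinv (lmon \<mu>) = lmon (- \<mu>)"
  by (rule uinvI) (simp add: lmon_add[symmetric] single_one)

lemma is_screening_tilde_screening_tilde: "is_screening_tilde i (screening_tilde i)"
  unfolding screening_tilde_def by (rule theI'[OF is_screening_tilde_unique])

lemma screening_tilde_add: "screening_tilde i (f + g) = screening_tilde i f + screening_tilde i g"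
  and screening_tilde_mult:
    "screening_tilde i (f * g) = smult g (screening_tilde i f) + smult f (screening_tilde i g)"
  and screening_tilde_YY:
    "screening_tilde i (YY j a) = (if i = j then smult (YY i a) (S_gen a) else 0)"
  using is_screening_tilde_screening_tilde[of i] unfolding is_screening_tilde_def by blast+

lemma screening_tilde_zero: "screening_tilde i 0 = 0"
  using screening_tilde_add[of i 0 0] by simp

lemma screening_tilde_diff: "screening_tilde i (f - g) = screening_tilde i f - screening_tilde i g"
  using screening_tilde_add[of i "f - g" g] by simp

text \<open>Logarithmic derivatives are additive in the exponent vector, so it suffices to check the
  generators and their inverses.\<close>

lemma screening_tilde_lmon:
  "cf (screening_tilde i (lmon \<mu>)) x = Poly_Mapping.single \<mu> (cf \<mu> (i, x))"
proof -
  define P where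
    "P \<mu> \<longleftrightarrow> cf (screening_tilde i (lmon \<mu>)) x = Poly_Mapping.single \<mu> (cf \<mu> (i, x))" for \<mu>
  have add: "P (\<mu> + \<nu>)" if "P \<mu>" "P \<nu>" for \<mu> \<nu>
    using that unfolding P_def lmon_add screening_tilde_mult
    by (simp add: lookup_add mult_single single_add add.commute)
  have zero: "P 0"
    using screening_tilde_mult[of i 1 1] by (simp add: P_def single_one)
  have neg: "P (- \<mu>)" if "P \<mu>" for \<mu>
  proof -
    have "cf (screening_tilde i (lmon (\<mu> + - \<mu>))) x = 0"
      using zero by (simp add: P_def)
    then have "lmon (- \<mu>) * Poly_Mapping.single \<mu> (cf \<mu> (i, x)) +
        lmon \<mu> * cf (screening_tilde i (lmon (- \<mu>))) x = 0"
      using that unfolding P_def lmon_add screening_tilde_mult by (simp add: lookup_add)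
    then have "lmon (- \<mu>) * (lmon (- \<mu>) * Poly_Mapping.single \<mu> (cf \<mu> (i, x)) +
        lmon \<mu> * cf (screening_tilde i (lmon (- \<mu>))) x) = 0"
      by simp
    then have "Poly_Mapping.single (- \<mu>) (cf \<mu> (i, x)) + cf (screening_tilde i (lmon (- \<mu>))) x = 0"
      by (simp add: distrib_left mult.assoc[symmetric] mult_single)
    then show ?thesis
      by (simp add: P_def single_uminus add_eq_0_iff)
  qed
  have gen: "P (Poly_Mapping.single k 1)" for k
  proof -
    obtain j a where k: "k = (j, a)" by fastforce
    show ?thesis
      using screening_tilde_YY[of i j a]
      by (auto simp: P_def k YY_def S_gen_def lookup_single when_def)
  qed
  have nat: "P (Poly_Mapping.single k (int n))" for k n
    by (induction n) (use zero add gen in \<open>auto simp: single_add\<close>)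
  have single: "P (Poly_Mapping.single k c)" for k c
    by (cases c rule: int_cases2) (use nat neg in \<open>auto simp: single_uminus\<close>)
  have "P \<mu>"
    by (induction \<mu> rule: poly_mapping_induct) (use single add in auto)
  then show ?thesis by (simp add: P_def)
qed

text \<open>On the component \<open>S\<^sub>x\<close> the lifted screening operator is the Euler operator of the variable
  \<open>Y\<^bsub>i,x\<^esub>\<close>, which is diagonal in the basis of monomials. All later arguments use it in this form.\<close>

lemma lookup_screening_tilde: "cf (cf (screening_tilde i f) x) m = cf f m * cf m (i, x)"
proof (induction f rule: poly_mapping_induct)
  case (single \<mu> c)
  have nat: "cf (cf (screening_tilde i (Poly_Mapping.single \<mu> (int n))) x) m
      = cf (Poly_Mapping.single \<mu> (int n)) m * cf m (i, x)" for n
  proof (induction n)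
    case 0
    then show ?case by (simp add: screening_tilde_zero)
  next
    case (Suc n)
    then show ?case
      by (auto simp: single_add screening_tilde_add screening_tilde_lmon lookup_add lookup_single
          when_def algebra_simps)
  qed
  show ?case
  proof (cases c rule: int_cases2)
    case (nonneg n)
    then show ?thesis using nat by simp
  next
    case (nonpos n)
    then show ?thesis
      using nat[of n] screening_tilde_diff[of i 0 "Poly_Mapping.single \<mu> (int n)"]
      by (simp add: single_uminus screening_tilde_zero)
  qed
next
  case (sum f g)
  then show ?case by (simp add: screening_tilde_add lookup_add algebra_simps)
qed


section \<open>The group of nonzero complex numbers\<close>

lemma cstar_inverse_mult [simp]: "inverse x * x = (1 :: cstar)"
  and cstar_mult_inverse [simp]: "x * inverse x = 1"
  by (transfer; simp)+

abbreviation cnorm :: "cstar \<Rightarrow> real" where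
  "cnorm x \<equiv> norm (Rep_cstar x)"

lemma cnorm_mult: "cnorm (x * y) = cnorm x * cnorm y"
  by (simp add: times_cstar.rep_eq norm_mult)

lemma cnorm_pos: "0 < cnorm x"
  using Rep_cstar[of x] by simp

lemma cstar_mult_left_cancel [simp]: "x * y = x * z \<longleftrightarrow> y = (z :: cstar)"
  by transfer simp

lemma cstar_mult_right_cancel [simp]: "y * x = z * x \<longleftrightarrow> y = (z :: cstar)"
  by transfer simp

lemma cstar_ex_quotient: "\<exists>y. x = y * (t :: cstar)"
  by (rule exI[of _ "x * inverse t"]) (simp add: mult.assoc)

lemma cnorm_power: "cnorm (x ^ n) = cnorm x ^ n"
proof (induction n)
  case 0
  then show ?case by (simp add: one_cstar.rep_eq)
next
  case (Suc n)
  then show ?case by (simp add: cnorm_mult)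
qed

lemma cnorm_shift_less:
  assumes "cnorm t < 1" "0 < n"
  shows "cnorm (x * t ^ n) < cnorm x"
proof -
  have "cnorm t ^ n < 1"
    using assms cnorm_pos[of t] by (simp add: power_less_one_iff)
  then show ?thesis
    using cnorm_pos[of x] by (simp add: cnorm_mult cnorm_power)
qed

lemma inj_power_cstar:
  assumes "cnorm t < 1"
  shows "inj (\<lambda>n. x * t ^ n)"
proof (rule injI)
  fix m n assume "x * t ^ m = x * t ^ n"
  then have "cnorm t ^ m = cnorm t ^ n"
    by (simp flip: cnorm_power)
  then show "m = n"
    using assms cnorm_pos[of t] by (metis power_inject_exp' less_irrefl)
qed

section \<open>The kernel of a screening operator and its recurrence\<close>

text \<open>The screening operator in abstract form: the shift \<open>t\<close> stands for \<open>q\<^sub>i\<^sup>2\<close>, and \<open>\<mu> x\<close> for the exponent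
  vector of \<open>A\<^bsub>i,xq\<^sub>i\<^esub>\<close>, which contains the variables with index \<open>i\<close> exactly as in \<open>Y\<^bsub>i,x\<^esub> Y\<^bsub>i,xt\<^esub>\<close>.\<close>

locale screening_shift =
  fixes i :: 'i and t :: cstar and \<mu> :: "cstar \<Rightarrow> ('i \<times> cstar \<Rightarrow>\<^sub>0 int)"
  assumes contracting: "cnorm t < 1"
    and \<mu>_own: "cf (\<mu> x) (i, c) = of_bool (c = x) + of_bool (c = x * t)"
begin

lemma shift_inj: "x * t ^ m = x * t ^ n \<longleftrightarrow> m = n"
  by (rule inj_eq[OF inj_power_cstar[OF contracting]])

lemma shift_neq: "0 < n \<Longrightarrow> x * t ^ n \<noteq> x"
  using cnorm_shift_less[OF contracting, of n x] by auto

definition relations :: "'i sfree set" where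
  "relations = sfree.span (range (\<lambda>x. S_gen (x * t) - smult (lmon (\<mu> x)) (S_gen x)))"

definition kernel :: "'i yring set" where
  "kernel = {f. screening_tilde i f \<in> relations}"

definition zz :: "cstar \<Rightarrow> 'i yring" where
  "zz b = YY i b + YY i b * uinv (lmon (\<mu> b))"

definition zsub :: "'i yring set" where
  "zsub = is_subring hull
     ({YY j a | j a. j \<noteq> i} \<union> {uinv (YY j a) | j a. j \<noteq> i} \<union> {zz b | b. True})"

text \<open>A member of the submodule of relations is a combination \<open>\<Sum>\<^sub>x G\<^sub>x (S\<^bsub>xt\<^esub> - A\<^sub>x S\<^sub>x)\<close>. Comparing
  coefficients of \<open>S\<^bsub>xt\<^esub>\<close> turns membership into a two-term recurrence for the finitely supported
  family \<open>G\<close>.\<close>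

definition certifies :: "'i sfree \<Rightarrow> 'i sfree \<Rightarrow> bool" where
  "certifies G s \<longleftrightarrow>
     (\<forall>x. cf s (x * t) = cf G x - lmon (\<mu> (x * t)) * cf G (x * t))"

lemma relations_iff: "s \<in> relations \<longleftrightarrow> (\<exists>G. certifies G s)"
proof
  assume "s \<in> relations"
  then show "\<exists>G. certifies G s"
    unfolding relations_def
  proof (induction rule: sfree.span_induct)
    case base
    show ?case
    proof (rule sfree.subspaceI)
      show "0 \<in> {s. \<exists>G. certifies G s}"
        by (auto simp: certifies_def intro!: exI[of _ 0])
    next
      fix s s' assume "s \<in> {s. \<exists>G. certifies G s}" "s' \<in> {s. \<exists>G. certifies G s}"
      then obtain G G' where "certifies G s" "certifies G' s'" by blast
      then have "certifies (G + G') (s + s')"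
        by (simp add: certifies_def lookup_add distrib_left)
      then show "s + s' \<in> {s. \<exists>G. certifies G s}" by blast
    next
      fix c s assume "s \<in> {s. \<exists>G. certifies G s}"
      then obtain G where "certifies G s" by blast
      then have "certifies (smult c G) (smult c s)"
        by (simp add: certifies_def right_diff_distrib mult.left_commute)
      then show "smult c s \<in> {s. \<exists>G. certifies G s}" by blast
    qed
  next
    case (step s)
    then obtain x where "s = S_gen (x * t) - smult (lmon (\<mu> x)) (S_gen x)" by blast
    then have "certifies (S_gen x) s"
      by (auto simp: certifies_def S_gen_def lookup_minus lookup_single when_def)
    then show ?case by blast
  qed
next
  assume "\<exists>G. certifies G s"
  then obtain G where G: "certifies G s" ..
  define s' where "s' = (\<Sum>x\<in>Poly_Mapping.keys G.
    smult (cf G x) (S_gen (x * t) - smult (lmon (\<mu> x)) (S_gen x)))"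
  have "s' \<in> relations"
    unfolding s'_def relations_def
    by (intro sfree.span_sum sfree.span_scale sfree.span_base) blast
  moreover have "s = s'"
  proof (rule poly_mapping_eqI)
    fix y
    obtain x where y: "y = x * t" using cstar_ex_quotient by blast
    have "cf s' y = (\<Sum>z\<in>Poly_Mapping.keys G. (if z = x then cf G x else 0) -
        (if z = x * t then lmon (\<mu> (x * t)) * cf G (x * t) else 0))"
      unfolding s'_def lookup_sum y
      using shift_neq[of 1 x]
      by (intro sum.cong) (auto simp: S_gen_def lookup_minus lookup_single when_def)
    also have "\<dots> = cf G x - lmon (\<mu> (x * t)) * cf G (x * t)"
      by (auto simp: sum_subtractf in_keys_iff)
    finally show "cf s y = cf s' y"
      using G by (simp add: certifies_def y)
  qed
  ultimately show "s \<in> relations" by simp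
qed

lemma kernel_iff: "f \<in> kernel \<longleftrightarrow> (\<exists>G. certifies G (screening_tilde i f))"
  by (simp add: kernel_def relations_iff)

text \<open>The recurrence for single coefficients, where multiplication by \<open>A\<^bsub>xt\<^esub>\<close> is a translation.\<close>

lemma certifies_coeff:
  assumes "certifies G (screening_tilde i f)"
  shows "cf f m * cf m (i, x * t) = cf (cf G x) m - cf (cf G (x * t)) (m - \<mu> (x * t))"
proof -
  have "cf (cf (screening_tilde i f) (x * t)) m = cf (cf G x - lmon (\<mu> (x * t)) * cf G (x * t)) m"
    using assms by (simp add: certifies_def)
  then show ?thesis
    by (simp add: lookup_screening_tilde lookup_minus lookup_single_mult)
qed

lemma kernel_subring: "is_subring kernel"
proof -
  have "screening_tilde i 1 = 0"
    using screening_tilde_mult[of i 1 1] by simp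
  then show ?thesis
    unfolding is_subring_def kernel_def relations_def
    by (auto simp: screening_tilde_diff screening_tilde_mult sfree.span_zero
        intro!: sfree.span_diff sfree.span_add sfree.span_scale)
qed

lemma zz_eq: "zz b = lmon (Poly_Mapping.single (i, b) 1) +
    lmon (Poly_Mapping.single (i, b) 1 - \<mu> b)"
  by (simp add: zz_def YY_def uinv_lmon mult_single)

text \<open>The image of \<open>z\<^sub>b\<close> is \<open>y\<^sub>b S\<^sub>b - y\<^sub>b A\<^sub>b\<^sup>-\<^sup>1 S\<^bsub>bt\<^esub>\<close>, since \<open>y\<^sub>b A\<^sub>b\<^sup>-\<^sup>1\<close> contains \<open>y\<^bsub>bt\<^esub>\<close> with exponent
  \<open>-1\<close> and \<open>y\<^sub>b\<close> not at all; this is \<open>- y\<^sub>b A\<^sub>b\<^sup>-\<^sup>1\<close> times the relation at \<open>b\<close>.\<close>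

lemma zz_in_kernel: "zz b \<in> kernel"
proof -
  let ?\<nu> = "Poly_Mapping.single (i, b) 1 - \<mu> b"
  have "screening_tilde i (zz b) =
      smult (- lmon ?\<nu>) (S_gen (b * t) - smult (lmon (\<mu> b)) (S_gen b))"
  proof (intro poly_mapping_eqI[where 'a = cstar])
    fix x
    have "cf (screening_tilde i (zz b)) x =
        Poly_Mapping.single (Poly_Mapping.single (i, b) 1) (of_bool (x = b)) +
        Poly_Mapping.single ?\<nu> (- of_bool (x = b * t))"
      by (auto simp: zz_eq screening_tilde_add screening_tilde_lmon lookup_add lookup_minus \<mu>_own
          lookup_single when_def)
    then show "cf (screening_tilde i (zz b)) x =
        cf (smult (- lmon ?\<nu>) (S_gen (b * t) - smult (lmon (\<mu> b)) (S_gen b))) x"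
      using shift_neq[of 1 b]
      by (auto simp: S_gen_def lookup_minus lookup_single when_def mult_single single_uminus
          algebra_simps)
  qed
  then show ?thesis
    by (simp add: kernel_def relations_def del: sfree.scale_minus_left)
      (intro sfree.span_scale sfree.span_base, blast)
qed

lemma zsub_subset_kernel: "zsub \<subseteq> kernel"
proof -
  have "f \<in> kernel" if "screening_tilde i f = 0" for f
    using that by (simp add: kernel_def relations_def sfree.span_zero)
  moreover have "screening_tilde i (uinv (YY j a)) = 0" if "j \<noteq> i" for j a
    using that by (intro poly_mapping_eqI[where 'a = cstar])
      (simp add: YY_def uinv_lmon screening_tilde_lmon lookup_single)
  ultimately have "YY j a \<in> kernel" "uinv (YY j a) \<in> kernel" if "j \<noteq> i" for j a
    using that by (auto simp: screening_tilde_YY)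
  then show ?thesis
    unfolding zsub_def using zz_in_kernel by (intro hull_minimal kernel_subring) auto
qed

lemma zsub_is_subring: "is_subring zsub"
  unfolding zsub_def by (rule hull_in) (auto simp: is_subring_def)

lemma zsub_diff: "x \<in> zsub \<Longrightarrow> y \<in> zsub \<Longrightarrow> x - y \<in> zsub"
  and zsub_mult: "x \<in> zsub \<Longrightarrow> y \<in> zsub \<Longrightarrow> x * y \<in> zsub"
  and zsub_1: "1 \<in> zsub"
  using zsub_is_subring unfolding is_subring_def by blast+

lemma zsub_0: "0 \<in> zsub"
  using zsub_diff[OF zsub_1 zsub_1] by simp

lemma zsub_uminus: "x \<in> zsub \<Longrightarrow> - x \<in> zsub"
  using zsub_diff[OF zsub_0, of x] by simp

lemma zsub_add: "x \<in> zsub \<Longrightarrow> y \<in> zsub \<Longrightarrow> x + y \<in> zsub"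
  using zsub_diff[of x "- y"] zsub_uminus[of y] by simp

lemma zsub_power: "x \<in> zsub \<Longrightarrow> x ^ n \<in> zsub"
  by (induction n) (auto intro: zsub_1 zsub_mult)

lemma zz_in_zsub: "zz b \<in> zsub"
  unfolding zsub_def by (rule hull_inc) blast

lemma lmon_in_zsub:
  assumes "\<And>x. cf m (i, x) = 0"
  shows "lmon m \<in> zsub"
  using assms
proof (induction m rule: update_induct)
  case const
  then show ?case using zsub_1 by simp
next
  case (update m k v)
  obtain j a where k: "k = (j, a)" by fastforce
  have eq: "Poly_Mapping.update k v m = Poly_Mapping.single k v + m"
    using update.hyps by (intro poly_mapping_eqI)
      (auto simp: lookup_update lookup_add lookup_single in_keys_iff when_def)
  have ji: "j \<noteq> i"
    using update.prems[of a] update.hyps by (auto simp: k lookup_update)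
  have "cf m (i, x) = 0" for x
    using update.prems[of x] ji by (simp add: k lookup_update split: if_splits)
  then have m: "lmon m \<in> zsub" by (rule update.IH)
  have gen: "lmon (Poly_Mapping.single k 1) \<in> zsub" "lmon (Poly_Mapping.single k (-1)) \<in> zsub"
    using ji unfolding k zsub_def YY_def[symmetric] uinv_YY[symmetric] by (auto intro!: hull_inc)
  have nat: "lmon (Poly_Mapping.single k (int n)) \<in> zsub \<and>
      lmon (Poly_Mapping.single k (- int n)) \<in> zsub" for n
  proof (induction n)
    case 0
    then show ?case using zsub_1 by simp
  next
    case (Suc n)
    have "Poly_Mapping.single k (int (Suc n)) =
        Poly_Mapping.single k 1 + Poly_Mapping.single k (int n)"
      "Poly_Mapping.single k (- int (Suc n)) =
        Poly_Mapping.single k (-1) + Poly_Mapping.single k (- int n)"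
      by (simp_all flip: single_add)
    then show ?case using Suc gen by (simp only: lmon_add zsub_mult simp_thms)
  qed
  then have "lmon (Poly_Mapping.single k v) \<in> zsub"
    by (cases v rule: int_cases2) auto
  then show ?case using m by (simp only: eq lmon_add zsub_mult)
qed

text \<open>The base of the induction: no variable with index \<open>i\<close> is left.\<close>

lemma own_free_in_zsub:
  assumes "\<And>m x. cf f m \<noteq> 0 \<Longrightarrow> cf m (i, x) = 0"
  shows "f \<in> zsub"
  using assms
proof (induction f rule: update_induct)
  case const
  then show ?case using zsub_0 by simp
next
  case (update f m c)
  have eq: "Poly_Mapping.update m c f = of_int c * lmon m + f"
    using update.hyps by (intro poly_mapping_eqI)
      (auto simp: lookup_update lookup_add lookup_single in_keys_iff when_def mult_single
        simp flip: single_of_int)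
  have "cf m (i, x) = 0" for x
    using update.prems[of m x] update.hyps by (simp add: lookup_update)
  then have m: "lmon m \<in> zsub" by (rule lmon_in_zsub)
  have "cf m' (i, x) = 0" if "cf f m' \<noteq> 0" for m' x
    using update.prems[of m' x] update.hyps that
    by (auto simp: lookup_update in_keys_iff split: if_splits)
  then have f: "f \<in> zsub" by (rule update.IH)
  have nat: "of_nat n \<in> zsub" for n
    by (induction n) (auto intro: zsub_0 zsub_1 zsub_add)
  have "of_int c \<in> zsub"
    by (cases c rule: int_cases2) (auto intro: nat zsub_uminus)
  then show ?case using m f by (simp only: eq zsub_add zsub_mult)
qed

end

section \<open>Coefficients with respect to one variable\<close>

text \<open>The coefficient of the \<open>d\<close>-th power of the variable \<open>k\<close>, as a Laurent polynomial in the other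
  variables.\<close>

definition lcoef :: "'i \<times> cstar \<Rightarrow> int \<Rightarrow> 'i yring \<Rightarrow> 'i yring" where
  "lcoef k d f = Poly_Mapping.Abs_poly_mapping
     (\<lambda>m. if cf m k = 0 then cf f (m + Poly_Mapping.single k d) else 0)"

lemma lookup_lcoef:
  "cf (lcoef k d f) m = (if cf m k = 0 then cf f (m + Poly_Mapping.single k d) else 0)"
proof -
  let ?e = "Poly_Mapping.single k d"
  have "finite ((\<lambda>m. m - ?e) ` Poly_Mapping.keys f)" by simp
  moreover have "m \<in> (\<lambda>m. m - ?e) ` Poly_Mapping.keys f" if "cf f (m + ?e) \<noteq> 0" for m
    using that by (intro image_eqI[of _ _ "m + ?e"]) (simp_all add: in_keys_iff)
  then have "{m. (if cf m k = 0 then cf f (m + ?e) else 0) \<noteq> 0} \<subseteq>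
      (\<lambda>m. m - ?e) ` Poly_Mapping.keys f"
    by (auto split: if_splits)
  ultimately have "finite {m. (if cf m k = 0 then cf f (m + ?e) else 0) \<noteq> 0}"
    by (rule finite_subset[rotated])
  then show ?thesis by (simp add: lcoef_def)
qed

lemma lcoef_zero [simp]: "lcoef k d 0 = 0"
  by (rule poly_mapping_eqI) (simp add: lookup_lcoef)

text \<open>Filling the gaps of a finite set along the orbits of \<open>t\<close> keeps it finite, because each orbit is
  infinite and meets the set in finitely many points. Without gaps, \<open>bt \<notin> F\<close> means that no later
  point of the orbit of \<open>b\<close> is in \<open>F\<close>.\<close>

lemma gap_free_cover:
  assumes "cnorm t < 1" "finite F"
  obtains F' where "finite F'" "F \<subseteq> F'"
    "\<And>c n. c \<in> F' \<Longrightarrow> c * t ^ Suc n \<in> F' \<Longrightarrow> c * t \<in> F'"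
proof -
  define F' where "F' = {a * t ^ n | a n. a \<in> F \<and> (\<exists>m. a * t ^ (n + m) \<in> F)}"
  have "finite {n. \<exists>m. a * t ^ (n + m) \<in> F}" for a
  proof -
    have "finite {n. a * t ^ n \<in> F}"
      using finite_vimageI[OF assms(2) inj_power_cstar[OF assms(1), of a]] by (simp add: vimage_def)
    then have "finite (\<Union>N\<in>{n. a * t ^ n \<in> F}. {..N})" by simp
    then show ?thesis by (rule rev_finite_subset) auto
  qed
  then have "finite (\<Union>a\<in>F. (\<lambda>n. a * t ^ n) ` {n. \<exists>m. a * t ^ (n + m) \<in> F})"
    using assms(2) by blast
  then have fin: "finite F'"
    by (rule rev_finite_subset) (auto simp: F'_def)
  have sub: "F \<subseteq> F'"
  proof
    fix a assume "a \<in> F"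
    then have "a = a * t ^ 0 \<and> a \<in> F \<and> a * t ^ (0 + 0) \<in> F" by simp
    then show "a \<in> F'" unfolding F'_def by blast
  qed
  have conv: "c * t \<in> F'" if c_in: "c \<in> F'" "c * t ^ Suc n \<in> F'" for c n
  proof -
    obtain a k where c: "a \<in> F" "c = a * t ^ k" using c_in(1) unfolding F'_def by blast
    obtain a' k' m' where c': "c * t ^ Suc n = a' * t ^ k'" "a' * t ^ (k' + m') \<in> F"
      using c_in(2) unfolding F'_def by blast
    have "a * t ^ (Suc k + (n + m')) = c * t ^ Suc n * t ^ m'"
      by (simp add: c power_add mult_ac)
    also have "\<dots> = a' * t ^ (k' + m')"
      by (simp only: c'(1) power_add) (simp add: mult.assoc)
    finally have "a * t ^ (Suc k + (n + m')) \<in> F" using c' by simp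
    moreover have "c * t = a * t ^ Suc k" by (simp add: c mult_ac)
    ultimately show ?thesis using c(1) unfolding F'_def by blast
  qed
  show ?thesis using that[OF fin sub conv] .
qed

text \<open>Backward induction along a sequence that finally leaves the support of \<open>G\<close>; this is how the
  finiteness of a solution of the recurrence is exploited.\<close>

lemma finite_support_descent:
  fixes G :: "'a \<Rightarrow>\<^sub>0 'b::zero"
  assumes "inj y"
    and zero: "\<And>n. cf G (y n) = 0 \<Longrightarrow> P n"
    and step: "\<And>n. P (Suc n) \<Longrightarrow> P n"
  shows "P n"
proof -
  have "finite {n. y n \<in> Poly_Mapping.keys G}"
    using finite_vimageI[OF finite_keys \<open>inj y\<close>] by (simp add: vimage_def)
  then obtain N where N: "\<And>n. y n \<in> Poly_Mapping.keys G \<Longrightarrow> n \<le> N"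
    by (auto simp: finite_nat_set_iff_bounded_le)
  have top: "P (Suc N + n)"
  proof (rule zero, rule ccontr)
    assume "cf G (y (Suc N + n)) \<noteq> 0"
    then show False using N[of "Suc N + n"] by (simp add: in_keys_iff)
  qed
  have *: "P (k + n)" if "k \<le> Suc N" for k
    using that
  proof (induction rule: inc_induct)
    case base
    show ?case by (rule top)
  next
    case (step k)
    then show ?case using assms(3)[of "k + n"] by simp
  qed
  show ?thesis using *[of 0] by simp
qed

definition own_vars_in :: "'i \<Rightarrow> cstar set \<Rightarrow> 'i yring \<Rightarrow> bool" where
  "own_vars_in i F f \<longleftrightarrow> (\<forall>m x. cf f m \<noteq> 0 \<longrightarrow> cf m (i, x) \<noteq> 0 \<longrightarrow> x \<in> F)"

lemma own_vars_inD: "own_vars_in i F f \<Longrightarrow> x \<notin> F \<Longrightarrow> cf f m * cf m (i, x) = 0"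
  by (auto simp: own_vars_in_def)

section \<open>Peeling off the first variable of an orbit\<close>

context screening_shift
begin

text \<open>Since \<open>z\<^sub>b = y\<^sub>b + (\<dots>)\<close>, where the second term contains no \<open>y\<^sub>b\<close>, the powers of \<open>z\<^sub>b\<close> are monic
  polynomials in \<open>y\<^sub>b\<close>. The hypothesis \<open>bt \<in> F\<close> accounts for the variable \<open>y\<^bsub>bt\<^esub>\<close> in the second
  term.\<close>

lemma zz_power_mult:
  assumes "own_vars_in i F h" "b \<in> F" "b * t \<in> F" "\<And>m. cf h m \<noteq> 0 \<Longrightarrow> cf m (i, b) = 0"
  shows "own_vars_in i F (zz b ^ d * h) \<and>
    (\<forall>m. cf (zz b ^ d * h) m \<noteq> 0 \<longrightarrow> cf m (i, b) \<le> int d) \<and>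
    (\<forall>m. cf m (i, b) = int d \<longrightarrow>
      cf (zz b ^ d * h) m = cf h (m - Poly_Mapping.single (i, b) (int d)))"
proof (induction d)
  case 0
  then show ?case using assms by auto
next
  case (Suc d)
  let ?e = "Poly_Mapping.single (i, b) 1 :: 'i \<times> cstar \<Rightarrow>\<^sub>0 int"
  let ?p = "zz b ^ d * h"
  have rec: "cf (zz b ^ Suc d * h) m = cf ?p (m - ?e) + cf ?p (m - (?e - \<mu> b))" for m
    by (simp only: power_Suc mult.assoc zz_eq[of b] distrib_right lookup_add lookup_single_mult
        mult_1)
  have own: "cf (?e - \<mu> b) (i, x) = (if x = b * t then -1 else 0)" for x
    using shift_neq[of 1 b] by (auto simp: lookup_minus lookup_single \<mu>_own when_def)
  have "x \<in> F" if m: "cf (zz b ^ Suc d * h) m \<noteq> 0" and x: "cf m (i, x) \<noteq> 0" for m x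
  proof (rule ccontr)
    assume "x \<notin> F"
    with assms have "x \<noteq> b" "x \<noteq> b * t" by auto
    then have "cf (m - ?e) (i, x) \<noteq> 0" "cf (m - (?e - \<mu> b)) (i, x) \<noteq> 0"
      using x own[of x] by (auto simp: lookup_minus lookup_single)
    then have "cf ?p (m - ?e) = 0" "cf ?p (m - (?e - \<mu> b)) = 0"
      using Suc \<open>x \<notin> F\<close> unfolding own_vars_in_def by blast+
    then show False using m by (simp only: rec)
  qed
  moreover have e1: "cf (m - ?e) (i, b) = cf m (i, b) - 1" for m
    by (simp add: lookup_minus)
  have e2: "cf (m - (?e - \<mu> b)) (i, b) = cf m (i, b)" for m
    using own[of b] shift_neq[of 1 b] by (simp only: lookup_minus[of m]) auto
  have "cf m (i, b) \<le> int (Suc d)" if m: "cf (zz b ^ Suc d * h) m \<noteq> 0" for m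
  proof -
    have "cf ?p (m - ?e) \<noteq> 0 \<or> cf ?p (m - (?e - \<mu> b)) \<noteq> 0"
      using m by (auto simp only: rec)
    then have "cf (m - ?e) (i, b) \<le> int d \<or> cf (m - (?e - \<mu> b)) (i, b) \<le> int d"
      using Suc by blast
    then show ?thesis by (auto simp only: e1 e2)
  qed
  moreover have "cf (zz b ^ Suc d * h) m = cf h (m - Poly_Mapping.single (i, b) (int (Suc d)))"
    if m: "cf m (i, b) = int (Suc d)" for m
  proof -
    have "cf ?p (m - (?e - \<mu> b)) = 0"
    proof (rule ccontr)
      assume "cf ?p (m - (?e - \<mu> b)) \<noteq> 0"
      then have "cf (m - (?e - \<mu> b)) (i, b) \<le> int d" using Suc by blast
      then show False by (simp only: e2 m)
    qed
    moreover have "cf ?p (m - ?e) = cf h (m - ?e - Poly_Mapping.single (i, b) (int d))"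
      using Suc m by (simp add: lookup_minus)
    moreover have "m - ?e - Poly_Mapping.single (i, b) (int d) =
        m - Poly_Mapping.single (i, b) (int (Suc d))"
      by (simp add: single_add)
    ultimately show ?thesis by (simp only: rec)
  qed
  ultimately show ?case unfolding own_vars_in_def by blast
qed

text \<open>Before the first occurring variable of an orbit, the recurrence reads \<open>G\<^sub>x = A\<^bsub>xt\<^esub> G\<^bsub>xt\<^esub>\<close> with \<open>A\<^bsub>xt\<^esub>\<close>
  invertible. One nonzero value would force nonzero values at infinitely many points.\<close>

lemma certificate_vanishes_before_first:
  assumes G: "certifies G (screening_tilde i f)"
    and vars: "own_vars_in i F f" and before: "\<And>n. b * inverse t ^ Suc n \<notin> F"
  shows "cf G (b * inverse t ^ Suc n) = 0"
proof (rule finite_support_descent[where y = "\<lambda>n. b * inverse t ^ Suc n" and G = G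
      and P = "\<lambda>n. cf G (b * inverse t ^ Suc n) = 0"])
  show "inj (\<lambda>n. b * inverse t ^ Suc n)"
  proof (rule injI)
    fix m n assume *: "b * inverse t ^ Suc m = b * inverse t ^ Suc n"
    have inv: "inverse t ^ k * t ^ k = 1" for k
      by (simp flip: power_mult_distrib)
    have "inverse t ^ Suc m * t ^ Suc m * t ^ Suc n = inverse t ^ Suc n * t ^ Suc n * t ^ Suc m"
      using * by (simp only: cstar_mult_left_cancel mult_ac)
    then show "m = n" using shift_inj[of 1 "Suc n" "Suc m"] by (simp only: inv)
  qed
next
  fix n
  let ?y = "b * inverse t ^ Suc n" and ?z = "b * inverse t ^ Suc (Suc n)"
  assume z: "cf G ?z = 0"
  have zt: "?z * t = ?y"
    by (simp only: power_Suc2[of _ "Suc n"] mult.assoc cstar_inverse_mult mult_1_right)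
  show "cf G ?y = 0"
  proof (rule poly_mapping_eqI)
    fix m
    have "cf f (m + \<mu> ?y) * cf (m + \<mu> ?y) (i, ?y) = - cf (cf G ?y) m"
      using certifies_coeff[OF G, of "m + \<mu> ?y" ?z] z by (simp only: zt) simp
    then show "cf (cf G ?y) m = cf 0 m"
      using own_vars_inD[OF vars before[of n], of "m + \<mu> ?y"] by (simp del: power_Suc)
  qed
qed

text \<open>Let \<open>L\<close> be a lower bound for the exponents of \<open>y\<^sub>b\<close> in \<open>f\<close>. Going down from the end of the
  support, \<open>L\<close> is also a bound for all \<open>G\<close> at \<open>b t\<^sup>n\<close>, since the monomials \<open>A\<close> at the points \<open>b t\<^sup>n\<close>
  with \<open>n > 0\<close> are free of \<open>y\<^sub>b\<close>. In \<open>D\<^sub>b f = - A\<^sub>b G\<^sub>b\<close> the right side then has exponents at least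
  \<open>L + 1\<close>, while \<open>D\<^sub>b\<close> multiplies the part of exponent \<open>L\<close> by \<open>L\<close>. So that part vanishes if \<open>L < 0\<close>,
  and the bound can be raised until it is 0.\<close>

lemma kernel_exponent_nonneg:
  assumes G: "certifies G (screening_tilde i f)"
    and top: "b = c * t" "cf G c = 0"
    and m: "cf f m \<noteq> 0"
  shows "0 \<le> cf m (i, b)"
proof -
  have raise: "\<forall>m. cf f m \<noteq> 0 \<longrightarrow> L + 1 \<le> cf m (i, b)"
    if L: "\<forall>m. cf f m \<noteq> 0 \<longrightarrow> L \<le> cf m (i, b)" and "L < 0" for L
  proof -
    have "\<forall>m. cf (cf G (b * t ^ n)) m \<noteq> 0 \<longrightarrow> L \<le> cf m (i, b)" for n
    proof (rule finite_support_descent[where y = "\<lambda>n. b * t ^ n" and G = G])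
      show "inj (\<lambda>n. b * t ^ n)" by (rule inj_power_cstar[OF contracting])
    next
      fix n
      let ?x = "b * t ^ n"
      assume IH: "\<forall>m. cf (cf G (b * t ^ Suc n)) m \<noteq> 0 \<longrightarrow> L \<le> cf m (i, b)"
      have next_x: "b * t ^ Suc n = ?x * t" by (simp add: mult_ac)
      have "?x * t \<noteq> b" "?x * t * t \<noteq> b"
        using shift_neq[of "Suc n" b] shift_neq[of "Suc (Suc n)" b] by (simp_all add: mult_ac)
      then have free: "cf (\<mu> (?x * t)) (i, b) = 0"
        by (auto simp: \<mu>_own)
      show "\<forall>m. cf (cf G ?x) m \<noteq> 0 \<longrightarrow> L \<le> cf m (i, b)"
      proof (intro allI impI)
        fix m assume "cf (cf G ?x) m \<noteq> 0"
        then have "cf f m \<noteq> 0 \<or> cf (cf G (?x * t)) (m - \<mu> (?x * t)) \<noteq> 0"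
          using certifies_coeff[OF G, of m ?x] by auto
        then show "L \<le> cf m (i, b)"
          using L IH[unfolded next_x] free by (auto simp: lookup_minus)
      qed
    qed simp
    from this[of 0] have Gb: "\<forall>m. cf (cf G b) m \<noteq> 0 \<longrightarrow> L \<le> cf m (i, b)" by simp
    show ?thesis
    proof (intro allI impI)
      fix m assume m: "cf f m \<noteq> 0"
      have "cf m (i, b) \<noteq> L"
      proof
        assume eq: "cf m (i, b) = L"
        have "cf (m - \<mu> b) (i, b) < L"
          using shift_neq[of 1 b] by (simp add: lookup_minus \<mu>_own eq)
        then have "cf (cf G b) (m - \<mu> b) = 0" using Gb by fastforce
        then have "cf f m * L = 0"
          using certifies_coeff[OF G, of m c, folded top(1)] top(2) by (simp add: eq)
        then show False using m \<open>L < 0\<close> by simp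
      qed
      then show "L + 1 \<le> cf m (i, b)" using L m by fastforce
    qed
  qed
  have nat: "\<forall>m. cf f m \<noteq> 0 \<longrightarrow> 0 \<le> cf m (i, b)"
    if "\<forall>m. cf f m \<noteq> 0 \<longrightarrow> - int k \<le> cf m (i, b)" for k
    using that
  proof (induction k)
    case (Suc k)
    then show ?case using raise[of "- int (Suc k)"] by simp
  qed simp
  have "finite ((\<lambda>m. cf m (i, b)) ` Poly_Mapping.keys f)" by simp
  then obtain B where "\<And>m. m \<in> Poly_Mapping.keys f \<Longrightarrow> B \<le> cf m (i, b)"
    by (metis Min_le imageI)
  then have "\<forall>m. cf f m \<noteq> 0 \<longrightarrow> - int (nat (- B)) \<le> cf m (i, b)"
    by (fastforce simp: in_keys_iff)
  then show ?thesis using nat m by blast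
qed

text \<open>If no later point of the orbit of \<open>b\<close> occurs in \<open>f\<close>, descent from the end of the support gives
  \<open>G = 0\<close> from \<open>b\<close> on. Together with \<open>G = 0\<close> just before \<open>b\<close> this means \<open>D\<^sub>b f = 0\<close>.\<close>

lemma kernel_isolated_variable:
  assumes G: "certifies G (screening_tilde i f)"
    and top: "b = c * t" "cf G c = 0"
    and vars: "own_vars_in i F f" and after: "\<And>n. b * t ^ Suc n \<notin> F"
    and m: "cf f m \<noteq> 0"
  shows "cf m (i, b) = 0"
proof -
  have "cf G (b * t ^ n) = 0" for n
  proof (rule finite_support_descent[where y = "\<lambda>n. b * t ^ n" and G = G])
    show "inj (\<lambda>n. b * t ^ n)" by (rule inj_power_cstar[OF contracting])
  next
    fix n assume IH: "cf G (b * t ^ Suc n) = 0"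
    have next_x: "b * t ^ Suc n = b * t ^ n * t" by (simp add: mult_ac)
    show "cf G (b * t ^ n) = 0"
    proof (rule poly_mapping_eqI)
      fix m
      show "cf (cf G (b * t ^ n)) m = cf 0 m"
        using certifies_coeff[OF G, of m "b * t ^ n"] own_vars_inD[OF vars after[of n], of m] IH
        unfolding next_x by simp
    qed
  qed
  from this[of 0] have "cf f m * cf m (i, b) = 0"
    using certifies_coeff[OF G, of m c] top by simp
  then show ?thesis using m by simp
qed

text \<open>Taking the coefficient of \<open>y\<^sub>b\<^sup>d\<close> commutes with \<open>D\<^sub>x\<close> for \<open>x \<noteq> b\<close> and with multiplication by \<open>A\<^sub>x\<close>
  unless \<open>x = b\<close> or \<open>xt = b\<close>, so it can be applied to the whole recurrence. At the two exceptional
  points, \<open>b\<close> and \<open>c = b t\<^sup>-\<^sup>1\<close>, the new \<open>G\<close> is zero: at \<open>c\<close> by hypothesis, and at \<open>b\<close> because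
  \<open>A\<^sub>b G\<^sub>b = - D\<^sub>b f\<close> has degree at most \<open>d\<close>, whence \<open>G\<^sub>b\<close> has degree less than \<open>d\<close>.\<close>

lemma leading_coefficient_in_kernel:
  assumes G: "certifies G (screening_tilde i f)"
    and top: "b = c * t" "c = c' * t" "cf G c = 0" "cf G c' = 0"
    and deg: "\<And>m. cf f m \<noteq> 0 \<Longrightarrow> cf m (i, b) \<le> d"
  shows "lcoef (i, b) d f \<in> kernel"
proof -
  define G' where "G' = Poly_Mapping.map (lcoef (i, b) d) G"
  have G': "cf G' x = lcoef (i, b) d (cf G x)" for x
    by (simp add: G'_def Poly_Mapping.map.rep_eq when_def)
  have G'b: "cf G' b = 0"
  proof (rule poly_mapping_eqI)
    fix m
    let ?m = "m + Poly_Mapping.single (i, b) d"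
    show "cf (cf G' b) m = cf 0 m"
    proof (cases "cf m (i, b) = 0")
      case True
      have "cf (?m + \<mu> b) (i, b) = d + 1"
        using shift_neq[of 1 b] True by (simp add: lookup_add \<mu>_own)
      then have "cf f (?m + \<mu> b) = 0"
        using deg[of "?m + \<mu> b"] by fastforce
      then have "cf (cf G b) ?m = 0"
        using certifies_coeff[OF G, of "?m + \<mu> b" c] top by (simp add: add_ac)
      then show ?thesis using True by (simp add: G' lookup_lcoef)
    qed (simp add: G' lookup_lcoef)
  qed
  have "certifies G' (screening_tilde i (lcoef (i, b) d f))"
    unfolding certifies_def
  proof (intro allI poly_mapping_eqI)
    fix x m
    let ?m = "m + Poly_Mapping.single (i, b) d"
    have rhs: "cf (cf G' x - lmon (\<mu> (x * t)) * cf G' (x * t)) m =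
        cf (cf G' x) m - cf (cf G' (x * t)) (m - \<mu> (x * t))"
      by (simp add: lookup_minus lookup_single_mult)
    show "cf (cf (screening_tilde i (lcoef (i, b) d f)) (x * t)) m =
        cf (cf G' x - lmon (\<mu> (x * t)) * cf G' (x * t)) m"
    proof (cases "x * t = b")
      case True
      then have "x = c" using top by simp
      then have "cf G' x = 0" using top(3) by (simp add: G')
      then show ?thesis
        using True G'b by (simp add: rhs lookup_screening_tilde lookup_lcoef)
    next
      case False
      then have own: "cf ?m (i, x * t) = cf m (i, x * t)"
        by (simp add: lookup_add lookup_single)
      have pulled: "cf (cf G' (x * t)) (m - \<mu> (x * t)) =
          (if cf m (i, b) = 0 then cf (cf G (x * t)) (?m - \<mu> (x * t)) else 0)"
      proof (cases "x * t = c")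
        case True
        then have "cf G (x * t) = 0" by (simp only: top(3))
        then show ?thesis by (simp add: G')
      next
        case c: False
        then have "x * t * t \<noteq> b" using top by auto
        then have "cf (\<mu> (x * t)) (i, b) = 0" using False by (auto simp: \<mu>_own)
        moreover have "m - \<mu> (x * t) + Poly_Mapping.single (i, b) d = ?m - \<mu> (x * t)" by simp
        ultimately show ?thesis by (simp only: G' lookup_lcoef lookup_minus) simp
      qed
      have "cf (cf (screening_tilde i (lcoef (i, b) d f)) (x * t)) m =
          (if cf m (i, b) = 0 then cf f ?m * cf ?m (i, x * t) else 0)"
        by (simp add: lookup_screening_tilde lookup_lcoef own)
      also have "\<dots> = cf (cf G' x) m - cf (cf G' (x * t)) (m - \<mu> (x * t))"
        by (simp add: certifies_coeff[OF G] pulled) (simp add: G' lookup_lcoef)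
      finally show ?thesis by (simp only: rhs)
    qed
  qed
  then show ?thesis by (auto simp: kernel_iff)
qed

text \<open>An outer induction on the number of points of \<open>F\<close> removes the variable at the point \<open>b\<close> of maximal
  modulus; an inner induction on the degree in that variable expands \<open>f\<close> in powers of \<open>z\<^sub>b\<close>.\<close>

lemma kernel_element_in_zsub:
  assumes "finite F" "\<And>c n. c \<in> F \<Longrightarrow> c * t ^ Suc n \<in> F \<Longrightarrow> c * t \<in> F"
    and "f \<in> kernel" "own_vars_in i F f"
  shows "f \<in> zsub"
  using assms
proof (induction "card F" arbitrary: F f)
  case 0
  then have "F = {}" by simp
  then show ?case using 0 by (intro own_free_in_zsub) (auto simp: own_vars_in_def)
next
  case (Suc N)
  have "F \<noteq> {}" using Suc.hyps(2) by auto
  have "Max (cnorm ` F) \<in> cnorm ` F" using \<open>F \<noteq> {}\<close> Suc.prems(1) by (intro Max_in) auto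
  then obtain b where b: "b \<in> F" "cnorm b = Max (cnorm ` F)" by auto
  have max: "cnorm x \<le> cnorm b" if "x \<in> F" for x
    using that Suc.prems(1) by (simp add: b(2))
  (* modulus decreases along an orbit, so no point of F precedes b on its orbit *)
  have first: "x \<notin> F" if "b = x * t ^ Suc n" for x n
    using max[of x] cnorm_shift_less[OF contracting, of "Suc n" x] that by (auto simp del: power_Suc)
  have inv: "inverse t ^ k * t ^ k = 1" for k
    by (simp flip: power_mult_distrib)
  have before: "b * inverse t ^ Suc n \<notin> F" for n
    by (rule first[where n = n]) (simp only: mult.assoc inv mult_1_right)
  define c where "c = b * inverse t"
  define c' where "c' = b * inverse t ^ 2"
  have bc: "b = c * t" and cc': "c = c' * t"
    by (simp_all add: c_def c'_def mult.assoc power2_eq_square)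
  (* F without b still has no gaps, because b is the first point of its orbit *)
  have smaller: "g \<in> zsub" if "g \<in> kernel" "own_vars_in i (F - {b}) g" for g
  proof (rule Suc.hyps(1)[where F = "F - {b}"])
    show "x * t \<in> F - {b}" if "x \<in> F - {b}" "x * t ^ Suc n \<in> F - {b}" for x n
      using Suc.prems(2)[of x n] that first[where n = 0 and x = x] by auto
  qed (use that Suc.hyps(2) Suc.prems(1) b(1) in auto)
  have top: "cf G c = 0" "cf G c' = 0"
    if "certifies G (screening_tilde i g)" "own_vars_in i F g" for G g
    using certificate_vanishes_before_first[OF that before, of 0]
      certificate_vanishes_before_first[OF that before, of 1]
    by (simp_all add: c_def c'_def power2_eq_square)
  show ?case
  proof (cases "b * t \<in> F")
    case False
    then have after: "b * t ^ Suc n \<notin> F" for n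
      using Suc.prems(2)[OF b(1), of n] by blast
    obtain G where G: "certifies G (screening_tilde i f)"
      using Suc.prems(3) by (auto simp: kernel_iff)
    have "own_vars_in i (F - {b}) f"
      using kernel_isolated_variable[OF G bc top(1)[OF G Suc.prems(4)] Suc.prems(4) after]
        Suc.prems(4)
      by (auto simp: own_vars_in_def)
    then show ?thesis using smaller Suc.prems(3) by blast
  next
    case True
    have "g \<in> zsub" if "g \<in> kernel" "own_vars_in i F g"
      "\<forall>m. cf g m \<noteq> 0 \<longrightarrow> cf m (i, b) \<le> int d" for g d
      using that
    proof (induction d arbitrary: g)
      case 0
      obtain G where G: "certifies G (screening_tilde i g)"
        using "0.prems"(1) by (auto simp: kernel_iff)
      have "cf m (i, b) = 0" if "cf g m \<noteq> 0" for m
        using kernel_exponent_nonneg[OF G bc top(1)[OF G "0.prems"(2)] that] "0.prems"(3) that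
        by fastforce
      then have "own_vars_in i (F - {b}) g"
        using "0.prems"(2) by (auto simp: own_vars_in_def)
      then show ?case using smaller "0.prems"(1) by blast
    next
      case (Suc d)
      obtain G where G: "certifies G (screening_tilde i g)"
        using Suc.prems(1) by (auto simp: kernel_iff)
      define h where "h = lcoef (i, b) (int (Suc d)) g"
      have hker: "h \<in> kernel"
        unfolding h_def using Suc.prems(3)
        by (intro leading_coefficient_in_kernel[OF G bc cc' top[OF G Suc.prems(2)]]) auto
      have hb: "cf m (i, b) = 0" if "cf h m \<noteq> 0" for m
        using that by (auto simp: h_def lookup_lcoef split: if_splits)
      have hvars: "own_vars_in i (F - {b}) h"
        unfolding own_vars_in_def
      proof (intro allI impI)
        fix m x assume m: "cf h m \<noteq> 0" "cf m (i, x) \<noteq> 0"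
        have "x \<noteq> b" using hb m by auto
        then have "cf g (m + Poly_Mapping.single (i, b) (int (Suc d))) \<noteq> 0"
          "cf (m + Poly_Mapping.single (i, b) (int (Suc d))) (i, x) \<noteq> 0"
          using m by (auto simp: h_def lookup_lcoef lookup_add lookup_single split: if_splits)
        then show "x \<in> F - {b}" using Suc.prems(2) \<open>x \<noteq> b\<close> unfolding own_vars_in_def by blast
      qed
      then have hvarsF: "own_vars_in i F h" by (auto simp: own_vars_in_def)
      have hz: "h \<in> zsub" using smaller hker hvars by blast
      define p where "p = zz b ^ Suc d * h"
      have pz: "p \<in> zsub" unfolding p_def by (intro zsub_mult zsub_power zz_in_zsub hz)
      note P = zz_power_mult[OF hvarsF b(1) True hb, of "Suc d", folded p_def]
      (* p has the same leading coefficient as g, so the difference has smaller degree *)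
      have "g - p \<in> zsub"
      proof (rule Suc.IH)
        show "g - p \<in> kernel"
          using kernel_subring Suc.prems(1) pz zsub_subset_kernel unfolding is_subring_def by blast
        have or: "cf g m \<noteq> 0 \<or> cf p m \<noteq> 0" if "cf (g - p) m \<noteq> 0" for m
          using that by (auto simp: lookup_minus)
        show "own_vars_in i F (g - p)"
          using or Suc.prems(2) P unfolding own_vars_in_def by blast
        show "\<forall>m. cf (g - p) m \<noteq> 0 \<longrightarrow> cf m (i, b) \<le> int d"
        proof (intro allI impI)
          fix m assume m: "cf (g - p) m \<noteq> 0"
          then have le: "cf m (i, b) \<le> int (Suc d)" using or[OF m] Suc.prems(3) P by blast
          have "cf m (i, b) \<noteq> int (Suc d)"
          proof
            assume eq: "cf m (i, b) = int (Suc d)"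
            then have "cf p m = cf h (m - Poly_Mapping.single (i, b) (int (Suc d)))"
              using P by blast
            also have "\<dots> = cf g m"
              using eq by (simp add: h_def lookup_lcoef lookup_minus del: of_nat_Suc)
            finally show False using m by (simp add: lookup_minus)
          qed
          then show "cf m (i, b) \<le> int d" using le by simp
        qed
      qed
      then have "(g - p) + p \<in> zsub" using pz by (rule zsub_add)
      then show ?case by simp
    qed
    moreover have "\<exists>d. \<forall>m. cf f m \<noteq> 0 \<longrightarrow> cf m (i, b) \<le> int d"
    proof -
      have "finite ((\<lambda>m. nat (cf m (i, b))) ` Poly_Mapping.keys f)" by simp
      then obtain d where "\<And>m. m \<in> Poly_Mapping.keys f \<Longrightarrow> nat (cf m (i, b)) \<le> d"
        by (metis Max_ge imageI)
      then show ?thesis by (intro exI[of _ d]) (fastforce simp: in_keys_iff)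
    qed
    ultimately show ?thesis using Suc.prems(3,4) by blast
  qed
qed

theorem kernel_eq_zsub: "kernel = zsub"
proof (intro equalityI zsub_subset_kernel subsetI)
  fix f assume f: "f \<in> kernel"
  let ?F = "\<Union>m\<in>Poly_Mapping.keys f. snd ` Poly_Mapping.keys m"
  have "finite ?F" by simp
  obtain F where F: "finite F" "?F \<subseteq> F"
    "\<And>c n. c \<in> F \<Longrightarrow> c * t ^ Suc n \<in> F \<Longrightarrow> c * t \<in> F"
    by (rule gap_free_cover[OF contracting \<open>finite ?F\<close>]) blast
  have "own_vars_in i ?F f" by (force simp: own_vars_in_def in_keys_iff)
  then have "own_vars_in i F f" using F(2) by (auto simp: own_vars_in_def)
  then show "f \<in> zsub" by (intro kernel_element_in_zsub[OF F(1) _ f]) (auto intro: F(3))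
qed

end

section \<open>Screening operators of a simple Lie algebra\<close>

text \<open>The shape of the factors of \<open>A\<^bsub>i,a\<^esub>\<close> that come from the neighbours of \<open>i\<close> in the Dynkin diagram.\<close>

definition monomial_free_of :: "'i \<Rightarrow> 'i yring \<Rightarrow> bool" where
  "monomial_free_of i u \<longleftrightarrow> (\<exists>\<nu>. u = lmon \<nu> \<and> (\<forall>c. cf \<nu> (i, c) = 0))"

lemma monomial_free_of_1: "monomial_free_of i 1"
  unfolding monomial_free_of_def by (rule exI[of _ 0]) (simp add: single_one)

lemma monomial_free_of_mult:
  assumes "monomial_free_of i u" "monomial_free_of i v"
  shows "monomial_free_of i (u * v)"
proof -
  obtain \<nu> \<nu>' where "u = lmon \<nu>" "v = lmon \<nu>'" "\<forall>c. cf \<nu> (i, c) = 0" "\<forall>c. cf \<nu>' (i, c) = 0"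
    using assms unfolding monomial_free_of_def by blast
  then show ?thesis
    unfolding monomial_free_of_def by (intro exI[of _ "\<nu> + \<nu>'"]) (simp add: lmon_add lookup_add)
qed

lemma monomial_free_of_prod:
  "(\<And>j. j \<in> J \<Longrightarrow> monomial_free_of i (f j)) \<Longrightarrow> monomial_free_of i (prod f J)"
  by (induction J rule: infinite_finite_induct)
    (auto intro: monomial_free_of_1 monomial_free_of_mult)

lemma monomial_free_of_uinv_YY: "j \<noteq> i \<Longrightarrow> monomial_free_of i (uinv (YY j a))"
  unfolding monomial_free_of_def uinv_YY
  by (intro exI[of _ "Poly_Mapping.single (j, a) (-1)"]) (simp add: lookup_single)

lemma AA_lmon:
  assumes "ip (\<alpha> i) (\<alpha> i) \<noteq> 0"
  shows "\<exists>\<mu>. AA ip \<alpha> q i (x * qi ip \<alpha> q i) = lmon \<mu> \<and>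
    (\<forall>c. cf \<mu> (i, c) = of_bool (c = x) + of_bool (c = x * (qi ip \<alpha> q i)^2))"
proof -
  let ?p = "qi ip \<alpha> q i" and ?a = "x * qi ip \<alpha> q i"
  (* so the index j = i occurs in none of the three products *)
  have self: "cartan_matrix ip \<alpha> i i = 2"
    using assms by (simp add: cartan_matrix_def)
  define w where "w =
     (\<Prod>j | cartan_matrix ip \<alpha> j i = -1. uinv (YY j ?a)) *
     (\<Prod>j | cartan_matrix ip \<alpha> j i = -2. uinv (YY j (?a * q)) * uinv (YY j (?a * inverse q))) *
     (\<Prod>j | cartan_matrix ip \<alpha> j i = -3.
        uinv (YY j (?a * q^2)) * uinv (YY j ?a) * uinv (YY j (?a * inverse (q^2))))"
  have "monomial_free_of i w"
    unfolding w_def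
    by (intro monomial_free_of_mult monomial_free_of_prod monomial_free_of_uinv_YY)
      (use self in auto)
  then obtain \<nu> where \<nu>: "w = lmon \<nu>" "\<And>c. cf \<nu> (i, c) = 0"
    unfolding monomial_free_of_def by blast
  have eq: "AA ip \<alpha> q i ?a = YY i (?a * ?p) * YY i (?a * inverse ?p) * lmon \<nu>"
    unfolding AA_def \<nu>(1)[symmetric] w_def by (simp only: mult.assoc)
  have "?a * ?p = x * ?p^2" "?a * inverse ?p = x"
    by (simp_all add: power2_eq_square mult.assoc)
  then have "AA ip \<alpha> q i ?a = lmon (Poly_Mapping.single (i, x * ?p^2) 1 +
      Poly_Mapping.single (i, x) 1 + \<nu>)" (is "_ = lmon ?\<mu>")
    by (simp only: eq YY_def lmon_add)
  moreover have "cf ?\<mu> (i, c) = of_bool (c = x) + of_bool (c = x * ?p^2)" for c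
    by (auto simp: lookup_add \<nu>(2) lookup_single when_def)
  ultimately show ?thesis by blast
qed

text \<open>Positive definiteness, applied to the combination of simple roots with a single coefficient 1.\<close>

lemma simple_root_norm_pos:
  fixes \<alpha> :: "'i::finite \<Rightarrow> 'g::ab_group_add \<Rightarrow> complex"
  assumes "invariant_inner_product sc br h \<alpha> ip"
  obtains r where "0 < r" "ip (\<alpha> i) (\<alpha> i) = of_real r"
proof -
  have "(\<lambda>t. \<Sum>j\<in>UNIV. of_real (of_bool (j = i)) * \<alpha> j t) = \<alpha> i"
  proof
    fix t
    have "(\<Sum>j\<in>UNIV. of_real (of_bool (j = i)) * \<alpha> j t) = (\<Sum>j\<in>UNIV. if j = i then \<alpha> j t else 0)"
      by (intro sum.cong) auto
    then show "(\<Sum>j\<in>UNIV. of_real (of_bool (j = i)) * \<alpha> j t) = \<alpha> i t" by simp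
  qed
  moreover have "\<exists>j. of_bool (j = i) \<noteq> (0 :: real)" by (rule exI[of _ i]) simp
  moreover have pos: "(\<exists>j. c j \<noteq> 0) \<longrightarrow> (let \<mu> = (\<lambda>t. \<Sum>j\<in>UNIV. of_real (c j) * \<alpha> j t) in
      ip \<mu> \<mu> \<in> \<real> \<and> Re (ip \<mu> \<mu>) > 0)" for c :: "'i \<Rightarrow> real"
    by (rule spec[OF conjunct2[OF assms[unfolded invariant_inner_product_def]]])
  ultimately have "ip (\<alpha> i) (\<alpha> i) \<in> \<real>" "0 < Re (ip (\<alpha> i) (\<alpha> i))"
    using pos[of "\<lambda>j. of_bool (j = i)"] by (simp_all only: Let_def simp_thms)
  then show ?thesis using that[of "Re (ip (\<alpha> i) (\<alpha> i))"] by (simp add: of_real_Re)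
qed

text \<open>For a real exponent the modulus of a complex power does not depend on the branch.\<close>

lemma cnorm_qi_less_1:
  assumes "ip (\<alpha> i) (\<alpha> i) = of_real r" "0 < r" "cnorm q < 1"
  shows "cnorm (qi ip \<alpha> q i) < 1"
proof -
  have q: "Rep_cstar q \<noteq> 0" using Rep_cstar[of q] by simp
  have "cnorm (qi ip \<alpha> q i) = norm (Rep_cstar q powr of_real (r / 2))"
    using q assms(1) by (simp add: qi_def rr_def Abs_cstar_inverse)
  also have "\<dots> = exp (r / 2 * ln (cnorm q))"
    using q by (simp add: powr_def)
  also have "\<dots> < 1"
    using assms(2,3) cnorm_pos[of q] by (simp add: mult_pos_neg)
  finally show ?thesis .
qed

theorem proposition5p2:
  fixes sc :: "complex \<Rightarrow> 'g::ab_group_add \<Rightarrow> 'g"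
    and br :: "'g \<Rightarrow> 'g \<Rightarrow> 'g"
    and h :: "'g set"
    and \<alpha> :: "'i::finite \<Rightarrow> 'g \<Rightarrow> complex"
    and \<theta> :: "'g \<Rightarrow> complex"
    and ip :: "('g \<Rightarrow> complex) \<Rightarrow> ('g \<Rightarrow> complex) \<Rightarrow> complex"
    and q :: cstar
    and i :: 'i
  assumes "simple_lie_algebra sc br"
    and "cartan_subalgebra sc br h"
    and "simple_roots sc br h \<alpha>"
    and "invariant_inner_product sc br h \<alpha> ip"
    and "maximal_root sc br h \<alpha> \<theta>"
    and "ip \<theta> \<theta> = of_real (2 * max_edges ip \<alpha>)"
    and "norm (Rep_cstar q) < 1"
  shows "screening_kernel ip \<alpha> q i = KK ip \<alpha> q i"
proof -
  let ?p = "qi ip \<alpha> q i"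
  obtain r where r: "0 < r" "ip (\<alpha> i) (\<alpha> i) = of_real r"
    using simple_root_norm_pos[OF assms(4)] by blast
  then have "\<forall>x. \<exists>\<mu>. AA ip \<alpha> q i (x * ?p) = lmon \<mu> \<and>
      (\<forall>c. cf \<mu> (i, c) = of_bool (c = x) + of_bool (c = x * ?p^2))"
    by (intro allI AA_lmon) auto
  from choice[OF this] obtain \<mu> where \<mu>: "\<And>x. AA ip \<alpha> q i (x * ?p) = lmon (\<mu> x)"
    "\<And>x c. cf (\<mu> x) (i, c) = of_bool (c = x) + of_bool (c = x * ?p^2)"
    by blast
  have "cnorm (?p^2) < 1"
    using cnorm_qi_less_1[of ip \<alpha> i, OF r(2,1) assms(7)] cnorm_pos[of ?p]
    by (simp add: cnorm_power power_less_one_iff)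
  then interpret screening_shift i "?p^2" \<mu>
    by unfold_locales (use \<mu>(2) in auto)
  have rel: "screening_relations ip \<alpha> q i = relations"
    by (simp add: screening_relations_def relations_def \<mu>(1))
  have "screening ip \<alpha> q i f = screening_cong ip \<alpha> q i `` {0} \<longleftrightarrow> screening_tilde i f \<in> relations"
    for f
  proof -
    have "screening ip \<alpha> q i f = screening_cong ip \<alpha> q i `` {0} \<longleftrightarrow>
        (\<forall>s. screening_tilde i f - s \<in> relations \<longleftrightarrow> 0 - s \<in> relations)"
      by (simp add: screening_def screening_cong_def rel set_eq_iff)
    also have "\<dots> \<longleftrightarrow> screening_tilde i f \<in> relations"
    proof
      assume *: "\<forall>s. screening_tilde i f - s \<in> relations \<longleftrightarrow> 0 - s \<in> relations"
      show "screening_tilde i f \<in> relations"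
        using *[rule_format, of 0] by (simp add: relations_def sfree.span_zero)
    next
      assume *: "screening_tilde i f \<in> relations"
      show "\<forall>s. screening_tilde i f - s \<in> relations \<longleftrightarrow> 0 - s \<in> relations"
      proof (intro allI iffI)
        fix s assume "screening_tilde i f - s \<in> relations"
        then have "(screening_tilde i f - s) - screening_tilde i f \<in> relations"
          using * unfolding relations_def by (rule sfree.span_diff)
        then show "0 - s \<in> relations" by simp
      next
        fix s assume "0 - s \<in> relations"
        with * have "screening_tilde i f + (0 - s) \<in> relations"
          unfolding relations_def by (rule sfree.span_add)
        then show "screening_tilde i f - s \<in> relations" by simp
      qed
    qed
    finally show ?thesis .
  qed
  then have "screening_kernel ip \<alpha> q i = kernel"
    by (simp add: screening_kernel_def kernel_def)
  moreover have "KK ip \<alpha> q i = zsub"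
    by (simp add: KK_def zsub_def zz_def \<mu>(1))
  ultimately show ?thesis using kernel_eq_zsub by simp
qed

end
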